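(* Let all processes $z\in\mathbb{K}$ satisfy $z(k+t)=z(k)$ for all $k\in\{0,1,2,\dots\}$ and $t\in(0,1)$. Let $V:\mathfrak{C}\to\mathfrak{U}$ be a game value map, with $\bar v_n,\bar w_\mu\in\mathfrak{C}$ for all $n\in\mathbb{N}$, $\mu\in(0,1)$, such that the payoff families $\bar v_n$ $(n\in\mathbb{N})$ and $\bar w_\mu$ $(0<\mu<1)$ both enjoy the Dynamic Programming Principle. Then the following two statements are equivalent: (i) The sequence of functions $V[\bar v_n]$ $(n\in\mathbb{N})$ converges uniformly on $\Omega$ as $n\uparrow\infty$. (ii) The family of functions $V[\bar w_\mu]$ $(0<\mu<1)$ converges uniformly on $\Omega$ as $\mu\downarrow0$. Moreover, when at least one of these statements holds, we have $$\lim_{n\uparrow\infty}V[\bar v_n](\omega)=\lim_{\mu\downarrow0}V[\bar w_\mu](\omega)\qquad\forall\omega\in\Omega.$$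
   Context: Setting: $\mathbb{R}_+=[0,\infty)$, $\mathbb{N}=\{1,2,\dots\}$. $\Omega$ is a nonempty set; $\mathbb{K}$ is a nonempty set of maps from $\mathbb{R}_+$ to $\Omega$; $g:\Omega\to[0,1]$ is a running cost such that for every $z\in\mathbb{K}$ the map $t\mapsto g(z(t))$ is Borel measurable. Game value map: $\mathfrak{U}$ is the set of all bounded maps $\Omega\to\mathbb{R}$. $\mathfrak{C}$ is a nonempty set of maps $\mathbb{K}\to\mathbb{R}$ such that $Ac+B\in\mathfrak{C}$ for all $c\in\mathfrak{C}$, $A\ge0$, $B\in\mathbb{R}$. A map $V:\mathfrak{C}\to\mathfrak{U}$ is a game value map if (1) $V[Ac+B]=A\,V[c]+B$ for all $c\in\mathfrak{C}$, $A\ge 0$, $B\in\mathbb{R}$; and (2) for $c_1,c_2\in\mathfrak{C}$, if $c_1(z)\le c_2(z)$ for all $z\in\mathbb{K}$ then $V[c_1](\omega)\le V[c_2](\omega)$ for all $\omega\in\Omega$. Payoffs: for $n\in\mathbb{N}$, $\mu\in(0,1)$, $z\in\mathbb{K}$, $$\bar v_n(z)=\frac1n\sum_{t=0}^{n-1}g(z(t)),\qquad \bar w_\mu(z)=\mu\sum_{t=0}^\infty(1-\mu)^t g(z(t)).$$ Dynamic Programming Principle (DPP): the family $\bar v_n$ $(n\in\mathbb{N})$ enjoys the DPP iff for all $n,h\in\mathbb{N}$ the payoff $$\mathbb{K}\ni z\mapsto \frac1{n+h}\sum_{t=0}^{h-1}g(z(t))+\frac{n}{n+h}V[\bar v_n](z(h))$$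 lies in $\mathfrak{C}$ and the value of $V$ at this payoff is $V[\bar v_{n+h}]$. The family $\bar w_\mu$ $(0<\mu<1)$ enjoys the DPP iff for all $\mu\in(0,1)$ and all $h\in\mathbb{N}$ the payoff $$\mathbb{K}\ni z\mapsto \mu\sum_{t=0}^{h-1}(1-\mu)^t g(z(t))+(1-\mu)^hV[\bar w_\mu](z(h))$$ lies in $\mathfrak{C}$ and the value of $V$ at this payoff is $V[\bar w_\mu]$. *)

theory Defs
  imports "HOL-Analysis.Analysis"
begin

text \<open>
  Maps with a set as domain are represented by extensional functions, so that two maps are
  equal iff they agree on that domain: a process is an element of \<open>{0..} \<rightarrow>\<^sub>E \<Omega>\<close>, a payoff an
  element of \<open>extensional K\<close>, and a value an element of \<open>bounded_maps \<Omega>\<close>.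
\<close>

definition bounded_maps :: "'w set \<Rightarrow> ('w \<Rightarrow> real) set" where
  "bounded_maps \<Omega> = {u \<in> extensional \<Omega>. bounded (u ` \<Omega>)}"

definition payoff_class :: "(real \<Rightarrow> 'w) set \<Rightarrow> ((real \<Rightarrow> 'w) \<Rightarrow> real) set \<Rightarrow> bool" where
  "payoff_class K C \<longleftrightarrow>
     C \<noteq> {} \<and> C \<subseteq> extensional K \<and>
     (\<forall>c\<in>C. \<forall>A\<ge>0. \<forall>B. (\<lambda>z\<in>K. A * c z + B) \<in> C)"

definition game_value_map ::
  "'w set \<Rightarrow> (real \<Rightarrow> 'w) set \<Rightarrow> ((real \<Rightarrow> 'w) \<Rightarrow> real) set
    \<Rightarrow> (((real \<Rightarrow> 'w) \<Rightarrow> real) \<Rightarrow> 'w \<Rightarrow> real) \<Rightarrow> bool" where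
  "game_value_map \<Omega> K C V \<longleftrightarrow>
     V \<in> C \<rightarrow> bounded_maps \<Omega> \<and>
     (\<forall>c\<in>C. \<forall>A\<ge>0. \<forall>B. \<forall>\<omega>\<in>\<Omega>. V (\<lambda>z\<in>K. A * c z + B) \<omega> = A * V c \<omega> + B) \<and>
     (\<forall>c1\<in>C. \<forall>c2\<in>C. (\<forall>z\<in>K. c1 z \<le> c2 z) \<longrightarrow> (\<forall>\<omega>\<in>\<Omega>. V c1 \<omega> \<le> V c2 \<omega>))"

definition v_bar :: "('w \<Rightarrow> real) \<Rightarrow> (real \<Rightarrow> 'w) set \<Rightarrow> nat \<Rightarrow> (real \<Rightarrow> 'w) \<Rightarrow> real" where
  "v_bar g K n = (\<lambda>z\<in>K. 1 / real n * (\<Sum>t<n. g (z (real t))))"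

definition w_bar :: "('w \<Rightarrow> real) \<Rightarrow> (real \<Rightarrow> 'w) set \<Rightarrow> real \<Rightarrow> (real \<Rightarrow> 'w) \<Rightarrow> real" where
  "w_bar g K \<mu> = (\<lambda>z\<in>K. \<mu> * (\<Sum>t. (1 - \<mu>) ^ t * g (z (real t))))"

definition DPP_v ::
  "('w \<Rightarrow> real) \<Rightarrow> (real \<Rightarrow> 'w) set \<Rightarrow> ((real \<Rightarrow> 'w) \<Rightarrow> real) set
    \<Rightarrow> (((real \<Rightarrow> 'w) \<Rightarrow> real) \<Rightarrow> 'w \<Rightarrow> real) \<Rightarrow> bool" where
  "DPP_v g K C V \<longleftrightarrow>
     (\<forall>n\<ge>1. \<forall>h\<ge>1.
        let c = (\<lambda>z\<in>K. 1 / real (n + h) * (\<Sum>t<h. g (z (real t)))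
                       + real n / real (n + h) * V (v_bar g K n) (z (real h)))
        in c \<in> C \<and> V c = V (v_bar g K (n + h)))"

definition DPP_w ::
  "('w \<Rightarrow> real) \<Rightarrow> (real \<Rightarrow> 'w) set \<Rightarrow> ((real \<Rightarrow> 'w) \<Rightarrow> real) set
    \<Rightarrow> (((real \<Rightarrow> 'w) \<Rightarrow> real) \<Rightarrow> 'w \<Rightarrow> real) \<Rightarrow> bool" where
  "DPP_w g K C V \<longleftrightarrow>
     (\<forall>\<mu>\<in>{0<..<1}. \<forall>h::nat\<ge>1.
        let c = (\<lambda>z\<in>K. \<mu> * (\<Sum>t<h. (1 - \<mu>) ^ t * g (z (real t)))
                       + (1 - \<mu>) ^ h * V (w_bar g K \<mu>) (z (real h)))
        in c \<in> C \<and> V c = V (w_bar g K \<mu>))"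

end

theory Submission
  imports Defs
begin

text \<open>
  Write \<open>v n\<close> and \<open>w \<mu>\<close> for the values of the two payoffs. Over a block of \<open>h\<close> steps the
  unnormalised payoffs of the \<open>(n + h)\<close>-stage game and of the \<open>\<mu>\<close>-discounted game differ by at most
  \<open>\<mu> h\<^sup>2\<close>, so the two dynamic programming principles and monotonicity of \<open>V\<close> bound
  \<open>(n + h) v (n + h) - w \<mu> / \<mu>\<close> by \<open>\<mu> h\<^sup>2\<close> plus the supremum of
  \<open>\<bar>n v n - (1 - \<mu>)\<^sup>h w \<mu> / \<mu>\<bar>\<close>. Taking \<open>n + h\<close> close to \<open>1 / \<mu>\<close> and \<open>h\<close> close to
  \<open>\<theta> / \<mu>\<close>, both \<open>n\<close> and \<open>(1 - \<mu>)\<^sup>h / \<mu>\<close> equal \<open>(1 - \<theta>) / \<mu>\<close> up to \<open>O(\<theta>\<^sup>2 / \<mu>)\<close>. If one of the families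
  is within \<open>\<theta>\<^sup>2\<close> of its limit \<open>u\<close>, the distance of the other one to \<open>u\<close> is therefore
  contracted by a factor \<open>1 - c \<theta>\<close> up to an error \<open>O(\<theta>\<^sup>2)\<close>, and hence ends up being \<open>O(\<theta>)\<close>.
\<close>

section \<open>Second-order bounds for powers of \<open>1 - x\<close>\<close>

text \<open>Passing from \<open>h\<close> to \<open>h + 1\<close> removes
  \<open>x * (1 - x) ^ h\<close>, at least \<open>x * (1 - h * x)\<close> by Bernoulli. The
  quadratic coefficient becomes \<open>h * h + h\<close>, which stays below
  \<open>(h + 1) * (h + 1)\<close>.\<close>

lemma one_minus_power_upper:
  fixes x :: real
  assumes "0 \<le> x" "x \<le> 1"
  shows "(1 - x) ^ h \<le> 1 - real h * x + (real h * x)\<^sup>2"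
proof (induction h)
  case 0
  then show ?case by simp
next
  case (Suc h)
  have "1 - real h * x \<le> (1 - x) ^ h"
    using Bernoulli_inequality[of "- x" h] assms by simp
  then have "x * (1 - real h * x) \<le> x * (1 - x) ^ h"
    using assms by (intro mult_left_mono)
  moreover have "(1 - x) ^ Suc h = (1 - x) ^ h - x * (1 - x) ^ h"
    by (simp add: algebra_simps)
  ultimately have "(1 - x) ^ Suc h
      \<le> 1 - real h * x + (real h * x)\<^sup>2 - x * (1 - real h * x)"
    using Suc.IH by linarith
  also have "\<dots> = 1 - real (Suc h) * x + (real h * real h + real h) * (x * x)"
    by (simp add: power2_eq_square algebra_simps)
  also have "\<dots> \<le> 1 - real (Suc h) * x + (real (Suc h) * real (Suc h)) * (x * x)"
    by (intro add_left_mono mult_right_mono) (auto simp: algebra_simps)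
  finally show ?case by (simp add: power2_eq_square algebra_simps)
qed

lemma abs_one_minus_power_diff_le:
  fixes x :: real
  assumes "0 \<le> x" "x \<le> 1"
  shows "\<bar>(1 - x) ^ h - (1 - real h * x)\<bar> \<le> (real h * x)\<^sup>2"
  using one_minus_power_upper[OF assms, of h] Bernoulli_inequality[of "- x" h] assms
  by (simp add: abs_le_iff)

lemma abs_add_diff_le:
  fixes a b c :: real
  assumes "\<bar>a\<bar> \<le> A" "\<bar>b\<bar> \<le> B" "\<bar>c\<bar> \<le> C"
  shows "\<bar>a + b - c\<bar> \<le> A + B + C"
  using assms by linarith

section \<open>Contraction estimates for coupled families of values\<close>

text \<open>\<open>coupling\<close> carries a bound from the end of a block of \<open>h\<close>
  steps back to its start. It concerns total costs, \<open>n * v n\<close> against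
  \<open>w \<mu> / \<mu>\<close>. The bound \<open>E\<close> is uniform over \<open>\<Omega>\<close>
  because the state reached after the block is not known.\<close>

locale coupled_values =
  fixes \<Omega> :: "'w set" and v :: "nat \<Rightarrow> 'w \<Rightarrow> real" and w :: "real \<Rightarrow> 'w \<Rightarrow> real"
  assumes v_bounds: "n \<ge> 1 \<Longrightarrow> \<omega> \<in> \<Omega> \<Longrightarrow> v n \<omega> \<in> {0..1}"
    and w_bounds: "\<mu> \<in> {0<..<1} \<Longrightarrow> \<omega> \<in> \<Omega> \<Longrightarrow> w \<mu> \<omega> \<in> {0..1}"
    and coupling:
      "n \<ge> 1 \<Longrightarrow> h \<ge> 1 \<Longrightarrow> \<mu> \<in> {0<..<1} \<Longrightarrow>
       (\<And>\<omega>. \<omega> \<in> \<Omega> \<Longrightarrow> \<bar>real n * v n \<omega> - (1 - \<mu>) ^ h * (w \<mu> \<omega> / \<mu>)\<bar> \<le> E) \<Longrightarrow>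
       \<omega> \<in> \<Omega> \<Longrightarrow> \<bar>real (n + h) * v (n + h) \<omega> - w \<mu> \<omega> / \<mu>\<bar> \<le> E + \<mu> * (real h)\<^sup>2"
begin

text \<open>Both \<open>d\<close> and its improvement concern the same \<open>\<mu>\<close>, so the
  estimate can be iterated without shrinking \<open>\<mu>\<close>. The factor
  \<open>1 - \<theta> / 2\<close> bounds \<open>(1 - \<mu>) ^ h\<close>, the weight of the
  discounted game after the block.\<close>

lemma w_contraction:
  assumes u: "\<And>\<omega>. \<omega> \<in> \<Omega> \<Longrightarrow> u \<omega> \<in> {0..1::real}"
    and \<theta>: "0 < \<theta>" "\<theta> \<le> 1/8" and \<mu>: "0 < \<mu>" "\<mu> \<le> \<theta>\<^sup>2" and N: "real N * \<mu> \<le> 1/2"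
    and v: "\<And>n \<omega>. n \<ge> N \<Longrightarrow> \<omega> \<in> \<Omega> \<Longrightarrow> \<bar>v n \<omega> - u \<omega>\<bar> \<le> \<theta>\<^sup>2"
    and d: "\<And>\<omega>. \<omega> \<in> \<Omega> \<Longrightarrow> \<bar>w \<mu> \<omega> - u \<omega>\<bar> \<le> d" and d0: "0 \<le> d" and \<omega>: "\<omega> \<in> \<Omega>"
  shows "\<bar>w \<mu> \<omega> - u \<omega>\<bar> \<le> (1 - \<theta> / 2) * d + 12 * \<theta>\<^sup>2"
proof -
  define h where "h = nat \<lceil>\<theta> / \<mu>\<rceil>"
  \<comment> \<open>By \<open>hle\<close> below the subtraction is not truncated, so
    \<open>n + h\<close> is the integer part of \<open>1 / \<mu>\<close>.\<close>
  define n where "n = nat \<lfloor>1 / \<mu>\<rfloor> - h"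
  have \<theta>2: "\<theta>\<^sup>2 \<le> \<theta> / 8"
    using \<theta> by (simp add: power2_eq_square)
  have \<mu>1: "\<mu> \<in> {0<..<1}" "\<mu> \<le> 1/64" using \<mu> \<theta> \<theta>2 by auto
  have "0 < \<theta> / \<mu>" using \<theta> \<mu> by simp
  then have h: "\<theta> / \<mu> \<le> real h" "real h \<le> \<theta> / \<mu> + 1" "h \<ge> 1"
    unfolding h_def by linarith+
  have h\<mu>: "\<theta> \<le> real h * \<mu>" "real h * \<mu> \<le> \<theta> + \<mu>"
    using h(1,2) \<mu> by (simp_all add: field_simps)
  then have h\<mu>2: "real h * \<mu> \<le> 2 * \<theta>" using \<mu> \<theta>2 \<theta> by linarith
  have fl: "real (nat \<lfloor>1 / \<mu>\<rfloor>) \<le> 1 / \<mu>" "1 / \<mu> - 1 \<le> real (nat \<lfloor>1 / \<mu>\<rfloor>)"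
    using \<mu> by simp linarith
  have "real h \<le> 2 * \<theta> / \<mu>" using h\<mu>2 \<mu> by (simp add: field_simps)
  also have "\<dots> \<le> (1/4) / \<mu>" using \<theta> \<mu> by (intro divide_right_mono) auto
  finally have h4: "real h \<le> (1/4) / \<mu>" .
  have inv: "1 / \<mu> \<ge> 64" using \<mu>1 \<mu> by (simp add: field_simps)
  have "real h \<le> real (nat \<lfloor>1 / \<mu>\<rfloor>)" using h4 fl inv by linarith
  then have hle: "h \<le> nat \<lfloor>1 / \<mu>\<rfloor>" by simp
  then have nh: "real n + real h = real (nat \<lfloor>1 / \<mu>\<rfloor>)" unfolding n_def by simp
  \<comment> \<open>As \<open>1 / \<mu>\<close> is at least 64, more than half of it remains after
    losing 1 to rounding and a quarter to \<open>h\<close>; this puts \<open>n\<close> in the range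
    where \<open>v n\<close> is close to \<open>u\<close>.\<close>
  have nlow: "real n \<ge> (1/2) / \<mu> + 1" using nh fl h4 inv by linarith
  moreover have "real N \<le> (1/2) / \<mu>" using N \<mu> by (simp add: field_simps)
  ultimately have nN: "n \<ge> N" and n1: "n \<ge> 1" using inv by linarith+
  \<comment> \<open>The summands stem from \<open>v n\<close> against \<open>u\<close>, from the
    remaining masses \<open>n\<close> and \<open>(1 - \<mu>) ^ h / \<mu>\<close>, and from
    \<open>w \<mu>\<close> against \<open>u\<close>.\<close>
  define E where "E = real n * \<theta>\<^sup>2 + (1 + \<mu> * (real h)\<^sup>2) + (1 - \<mu>) ^ h * d / \<mu>"
  have pw: "\<bar>(1 - \<mu>) ^ h - (1 - real h * \<mu>)\<bar> \<le> (real h * \<mu>)\<^sup>2"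
    using \<mu>1 by (intro abs_one_minus_power_diff_le) auto
  have "(1 - \<mu>) ^ h / \<mu> - (1 / \<mu> - real h) = ((1 - \<mu>) ^ h - (1 - real h * \<mu>)) / \<mu>"
    using \<mu> by (simp add: diff_divide_distrib)
  then have "\<bar>(1 - \<mu>) ^ h / \<mu> - (1 / \<mu> - real h)\<bar> = \<bar>(1 - \<mu>) ^ h - (1 - real h * \<mu>)\<bar> / \<mu>"
    using \<mu> by simp
  also have "\<dots> \<le> (real h * \<mu>)\<^sup>2 / \<mu>" using pw \<mu> by (intro divide_right_mono) auto
  also have "\<dots> = \<mu> * (real h)\<^sup>2" using \<mu> by (simp add: power2_eq_square field_simps)
  finally have pn: "\<bar>real n - (1 - \<mu>) ^ h / \<mu>\<bar> \<le> 1 + \<mu> * (real h)\<^sup>2"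
    using nh fl by linarith
  have close: "\<bar>real n * v n \<omega> - (1 - \<mu>) ^ h * (w \<mu> \<omega> / \<mu>)\<bar> \<le> E" if "\<omega> \<in> \<Omega>" for \<omega>
  proof -
    have eq: "real n * v n \<omega> - (1 - \<mu>) ^ h * (w \<mu> \<omega> / \<mu>) = real n * (v n \<omega> - u \<omega>)
        + (real n - (1 - \<mu>) ^ h / \<mu>) * u \<omega> - (1 - \<mu>) ^ h / \<mu> * (w \<mu> \<omega> - u \<omega>)"
      by (simp add: algebra_simps diff_divide_distrib)
    moreover have "\<bar>real n * (v n \<omega> - u \<omega>)\<bar> \<le> real n * \<theta>\<^sup>2"
      using v[OF nN that] by (simp add: abs_mult mult_left_mono)
    moreover have "\<bar>(real n - (1 - \<mu>) ^ h / \<mu>) * u \<omega>\<bar> \<le> (1 + \<mu> * (real h)\<^sup>2) * 1"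
      unfolding abs_mult using pn u[OF that] by (intro mult_mono) auto
    moreover have "\<bar>(1 - \<mu>) ^ h / \<mu> * (w \<mu> \<omega> - u \<omega>)\<bar> \<le> (1 - \<mu>) ^ h / \<mu> * d"
      using d[OF that] \<mu>1 by (simp add: abs_mult divide_right_mono mult_left_mono)
    ultimately show ?thesis
      unfolding eq using abs_add_diff_le by (fastforce simp: E_def)
  qed
  have "\<bar>real (n + h) * v (n + h) \<omega> - w \<mu> \<omega> / \<mu>\<bar> \<le> E + \<mu> * (real h)\<^sup>2"
    by (rule coupling[OF n1 h(3) \<mu>1(1) close \<omega>])
  moreover have "\<bar>real (n + h) * (v (n + h) \<omega> - u \<omega>)\<bar> \<le> real (n + h) * \<theta>\<^sup>2"
    using v[OF _ \<omega>, of "n + h"] nN by (simp add: abs_mult mult_left_mono)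
  moreover have "\<bar>(real (n + h) - 1 / \<mu>) * u \<omega>\<bar> \<le> 1 * 1"
    unfolding abs_mult using nh fl u[OF \<omega>] by (intro mult_mono) auto
  moreover have "w \<mu> \<omega> / \<mu> - u \<omega> / \<mu> = real (n + h) * (v (n + h) \<omega> - u \<omega>)
      + (real (n + h) - 1 / \<mu>) * u \<omega> - (real (n + h) * v (n + h) \<omega> - w \<mu> \<omega> / \<mu>)"
    by (simp add: algebra_simps)
  ultimately have "\<bar>w \<mu> \<omega> / \<mu> - u \<omega> / \<mu>\<bar> \<le> E + \<mu> * (real h)\<^sup>2 + real (n + h) * \<theta>\<^sup>2 + 1"
    by (simp only: abs_le_iff) linarith
  also have "\<dots> \<le> 1 / \<mu> * \<theta>\<^sup>2 + 1 / \<mu> * \<theta>\<^sup>2 + 2 + 2 * (\<mu> * (real h)\<^sup>2) + (1 - \<mu>) ^ h * d / \<mu>"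
  proof -
    have "real n * \<theta>\<^sup>2 \<le> 1 / \<mu> * \<theta>\<^sup>2" "real (n + h) * \<theta>\<^sup>2 \<le> 1 / \<mu> * \<theta>\<^sup>2"
      using nh fl by (intro mult_right_mono; simp)+
    then show ?thesis unfolding E_def by linarith
  qed
  finally have "\<bar>w \<mu> \<omega> / \<mu> - u \<omega> / \<mu>\<bar> * \<mu>
      \<le> (1 / \<mu> * \<theta>\<^sup>2 + 1 / \<mu> * \<theta>\<^sup>2 + 2 + 2 * (\<mu> * (real h)\<^sup>2) + (1 - \<mu>) ^ h * d / \<mu>) * \<mu>"
    using \<mu> by (intro mult_right_mono) auto
  also have "\<dots> = 2 * \<theta>\<^sup>2 + 2 * \<mu> + 2 * (real h * \<mu>)\<^sup>2 + (1 - \<mu>) ^ h * d"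
    using \<mu> by (simp add: field_simps power2_eq_square)
  also have "\<dots> \<le> 2 * \<theta>\<^sup>2 + 2 * \<theta>\<^sup>2 + 2 * (2 * \<theta>)\<^sup>2 + (1 - \<theta> / 2) * d"
  proof -
    have sq: "(real h * \<mu>)\<^sup>2 \<le> (2 * \<theta>)\<^sup>2"
      using h\<mu>2 \<mu> by (intro power_mono) auto
    \<comment> \<open>As \<open>h * \<mu>\<close> is at most 1/4, the quadratic error costs only a
      quarter of the linear gain, and three quarters of \<open>h * \<mu>\<close> exceed
      \<open>\<theta> / 2\<close>.\<close>
    have "(real h * \<mu>)\<^sup>2 \<le> (1/4) * (real h * \<mu>)"
      unfolding power2_eq_square using h\<mu>2 \<theta> \<mu> by (intro mult_right_mono) auto
    then have "(1 - \<mu>) ^ h \<le> 1 - \<theta> / 2" using pw h\<mu> \<theta> by linarith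
    then have "(1 - \<mu>) ^ h * d \<le> (1 - \<theta> / 2) * d" using d0 by (rule mult_right_mono)
    with sq \<mu> show ?thesis by linarith
  qed
  also have "\<dots> = (1 - \<theta> / 2) * d + 12 * \<theta>\<^sup>2"
    by (simp add: power2_eq_square)
  also have "\<bar>w \<mu> \<omega> / \<mu> - u \<omega> / \<mu>\<bar> * \<mu> = \<bar>w \<mu> \<omega> - u \<omega>\<bar>"
    using \<mu> by (simp add: abs_mult_pos left_diff_distrib)
  finally show ?thesis .
qed

text \<open>The value at \<open>m\<close> is compared with that at an earlier \<open>n\<close>, so
  \<open>d\<close> has to bound a whole tail; \<open>m\<close> is at least \<open>2 * N\<close>
  because \<open>n\<close> may drop to \<open>m / 2\<close>. With discount factor
  \<open>1 / m\<close> no rounding of \<open>1 / \<mu>\<close> occurs, and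
  \<open>1 - \<theta>\<close> bounds \<open>n / m\<close>.\<close>

lemma v_contraction:
  assumes u: "\<And>\<omega>. \<omega> \<in> \<Omega> \<Longrightarrow> u \<omega> \<in> {0..1::real}"
    and \<theta>: "0 < \<theta>" "\<theta> \<le> 1/8" and m: "1 \<le> \<theta> * real m" "2 * real N \<le> real m"
    and w: "\<And>\<omega>. \<omega> \<in> \<Omega> \<Longrightarrow> \<bar>w (1 / real m) \<omega> - u \<omega>\<bar> \<le> \<theta>\<^sup>2"
    and d: "\<And>n \<omega>. n \<ge> N \<Longrightarrow> n \<ge> 1 \<Longrightarrow> \<omega> \<in> \<Omega> \<Longrightarrow> \<bar>v n \<omega> - u \<omega>\<bar> \<le> d" and d0: "0 \<le> d"
    and \<omega>: "\<omega> \<in> \<Omega>"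
  shows "\<bar>v m \<omega> - u \<omega>\<bar> \<le> (1 - \<theta>) * d + 10 * \<theta>\<^sup>2"
proof -
  define h where "h = nat \<lceil>\<theta> * real m\<rceil>"
  define n where "n = m - h"
  define \<mu> where "\<mu> = 1 / real m"
  have "\<theta> * real m \<le> 1/8 * real m" using \<theta> by (intro mult_right_mono) auto
  then have m8: "real m \<ge> 8" and \<theta>m: "\<theta> * real m \<le> real m / 8" using m by linarith+
  have \<mu>: "\<mu> \<in> {0<..<1}" unfolding \<mu>_def using m8 by auto
  have h: "\<theta> * real m \<le> real h" "real h \<le> \<theta> * real m + 1"
    using m unfolding h_def by linarith+
  \<comment> \<open>The hypothesis that \<open>\<theta> * m\<close> is at least 1 absorbs the
    rounding up of \<open>h\<close>.\<close>
  then have h1: "h \<ge> 1" and hle: "real h \<le> 2 * \<theta> * real m" and hm: "h \<le> m"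
    using m \<theta>m m8 by linarith+
  have nh: "n + h = m" "real n = real m - real h" unfolding n_def using hm by auto
  have "real n \<ge> real m / 2" using nh hle \<theta>m by linarith
  then have nN: "n \<ge> N" and n1: "n \<ge> 1" using m m8 by linarith+
  have sq: "\<mu> * (real h)\<^sup>2 \<le> 4 * \<theta>\<^sup>2 * real m"
  proof -
    have "(real h)\<^sup>2 \<le> (2 * \<theta> * real m)\<^sup>2" using hle by (intro power_mono) auto
    then have "\<mu> * (real h)\<^sup>2 \<le> \<mu> * (2 * \<theta> * real m)\<^sup>2" using \<mu> by (intro mult_left_mono) auto
    also have "\<dots> = 4 * \<theta>\<^sup>2 * real m"
      unfolding \<mu>_def using m8 by (simp add: power2_eq_square)
    finally show ?thesis .
  qed
  \<comment> \<open>Since \<open>n = m * (1 - h * \<mu>)\<close>, the masses left after the block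
    differ by \<open>m\<close> times the second-order error of the power.\<close>
  have "(1 - \<mu>) ^ h * real m - real n = ((1 - \<mu>) ^ h - (1 - real h * \<mu>)) * real m"
    unfolding nh(2) \<mu>_def using m8 by (simp add: left_diff_distrib)
  then have "\<bar>(1 - \<mu>) ^ h * real m - real n\<bar> = \<bar>(1 - \<mu>) ^ h - (1 - real h * \<mu>)\<bar> * real m"
    by (simp add: abs_mult)
  also have "\<dots> \<le> (real h * \<mu>)\<^sup>2 * real m"
    using \<mu> by (intro mult_right_mono abs_one_minus_power_diff_le) auto
  also have "\<dots> = \<mu> * (real h)\<^sup>2"
    unfolding \<mu>_def using m8 by (simp add: power2_eq_square)
  finally have pn: "\<bar>(1 - \<mu>) ^ h * real m - real n\<bar> \<le> 4 * \<theta>\<^sup>2 * real m" using sq by linarith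
  define E where "E = real n * d + 4 * \<theta>\<^sup>2 * real m + real m * \<theta>\<^sup>2"
  have close: "\<bar>real n * v n \<omega> - (1 - \<mu>) ^ h * (w \<mu> \<omega> / \<mu>)\<bar> \<le> E" if "\<omega> \<in> \<Omega>" for \<omega>
  proof -
    have "w \<mu> \<omega> / \<mu> = real m * w \<mu> \<omega>" unfolding \<mu>_def by simp
    then have "real n * v n \<omega> - (1 - \<mu>) ^ h * (w \<mu> \<omega> / \<mu>) = real n * (v n \<omega> - u \<omega>)
        - ((1 - \<mu>) ^ h * real m - real n) * u \<omega> - (1 - \<mu>) ^ h * (real m * (w \<mu> \<omega> - u \<omega>))"
      by (simp add: algebra_simps)
    moreover have "\<bar>real n * (v n \<omega> - u \<omega>)\<bar> \<le> real n * d"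
      using d[OF nN n1 that] by (simp add: abs_mult mult_left_mono)
    moreover have "\<bar>((1 - \<mu>) ^ h * real m - real n) * u \<omega>\<bar> \<le> (4 * \<theta>\<^sup>2 * real m) * 1"
      unfolding abs_mult using pn u[OF that] by (intro mult_mono) auto
    moreover have "\<bar>(1 - \<mu>) ^ h * (real m * (w \<mu> \<omega> - u \<omega>))\<bar> \<le> 1 * (real m * \<theta>\<^sup>2)"
      unfolding abs_mult using w[OF that] \<mu>
      by (intro mult_mono) (auto simp: \<mu>_def power_le_one)
    ultimately show ?thesis unfolding E_def by (simp only: abs_le_iff) linarith
  qed
  have "\<bar>real (n + h) * v (n + h) \<omega> - w \<mu> \<omega> / \<mu>\<bar> \<le> E + \<mu> * (real h)\<^sup>2"
    by (rule coupling[OF n1 h1 \<mu> close \<omega>])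
  then have "\<bar>real m * v m \<omega> - real m * w \<mu> \<omega>\<bar> \<le> E + 4 * \<theta>\<^sup>2 * real m"
    using sq unfolding nh(1) by (simp add: \<mu>_def mult.commute)
  moreover have "\<bar>real m * (w \<mu> \<omega> - u \<omega>)\<bar> \<le> real m * \<theta>\<^sup>2"
    using w[OF \<omega>] by (simp add: abs_mult \<mu>_def mult_left_mono)
  moreover have "real m * (v m \<omega> - u \<omega>)
      = (real m * v m \<omega> - real m * w \<mu> \<omega>) + real m * (w \<mu> \<omega> - u \<omega>)"
    by (simp add: algebra_simps)
  ultimately have "\<bar>real m * (v m \<omega> - u \<omega>)\<bar> \<le> E + 4 * \<theta>\<^sup>2 * real m + real m * \<theta>\<^sup>2"
    by (simp only: abs_le_iff) linarith
  \<comment> \<open>In units of \<open>\<theta>\<^sup>2 * m\<close>, \<open>E\<close> contributes 4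
    + 1, the coupling 4, and the last comparison of \<open>w \<mu>\<close> with \<open>u\<close>
    1.\<close>
  also have "\<dots> \<le> (real m * (1 - \<theta>)) * d + 10 * \<theta>\<^sup>2 * real m"
  proof -
    have "real n \<le> real m * (1 - \<theta>)" using nh(2) h(1) by (simp add: algebra_simps)
    then have "real n * d \<le> (real m * (1 - \<theta>)) * d" using d0 by (rule mult_right_mono)
    then show ?thesis unfolding E_def by (simp add: algebra_simps)
  qed
  also have "\<dots> = real m * ((1 - \<theta>) * d + 10 * \<theta>\<^sup>2)" by (simp add: algebra_simps)
  finally have "real m * \<bar>v m \<omega> - u \<omega>\<bar> \<le> real m * ((1 - \<theta>) * d + 10 * \<theta>\<^sup>2)"
    by (simp add: abs_mult)
  then show ?thesis using m8 by (simp add: mult_le_cancel_left_pos)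
qed

section \<open>Transfer of uniform limits between the two families\<close>

text \<open>The map \<open>d \<mapsto> (1 - \<theta> / 2) * d + 12 * \<theta>\<^sup>2\<close> has
  the fixed point \<open>24 * \<theta>\<close>, towards which its iterates converge geometrically.
  The threshold for \<open>\<mu>\<close> and the number of iterations depend on neither
  \<open>\<mu>\<close> nor \<open>\<omega>\<close>.\<close>

lemma uniform_limit_w:
  assumes lim: "uniform_limit \<Omega> v u sequentially"
  shows "uniform_limit \<Omega> w u (at_right 0)"
proof (rule uniform_limitI)
  fix e :: real assume "e > 0"
  \<comment> \<open>The final error is \<open>25 * \<theta>\<close>: the fixed point plus at most
    \<open>\<theta>\<close> for the geometric term.\<close>
  define \<theta> where "\<theta> = min (1/8) (e / 50)"
  have \<theta>: "0 < \<theta>" "\<theta> \<le> 1/8" "25 * \<theta> < e" unfolding \<theta>_def using \<open>e > 0\<close> by auto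
  have u: "u \<omega> \<in> {0..1}" if "\<omega> \<in> \<Omega>" for \<omega>
    by (rule Lim_in_closed_set[OF _ _ _ tendsto_uniform_limitI[OF lim that]])
      (use v_bounds[OF _ that] in \<open>auto intro: eventually_sequentiallyI[of 1]\<close>)
  obtain N where N: "\<And>n \<omega>. n \<ge> N \<Longrightarrow> \<omega> \<in> \<Omega> \<Longrightarrow> \<bar>v n \<omega> - u \<omega>\<bar> \<le> \<theta>\<^sup>2"
    using uniform_limitD[OF lim, of "\<theta>\<^sup>2"] \<theta>
    by (force simp: eventually_sequentially dist_real_def intro: less_imp_le)
  obtain k where k: "(1 - \<theta> / 2) ^ k < \<theta>"
    using real_arch_pow_inv[of \<theta> "1 - \<theta> / 2"] \<theta> by auto
  \<comment> \<open>The threshold uses \<open>N + 1\<close>, which is positive even for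
    \<open>N = 0\<close>, to ensure that \<open>N * \<mu>\<close> is at most 1/2.\<close>
  have "dist (w \<mu> \<omega>) (u \<omega>) < e"
    if \<mu>: "0 < \<mu>" "\<mu> < min (\<theta>\<^sup>2) (1 / (2 * (real N + 1)))" and \<omega>: "\<omega> \<in> \<Omega>" for \<mu> \<omega>
  proof -
    have \<mu>1: "\<mu> \<le> \<theta>\<^sup>2" "real N * \<mu> \<le> 1/2"
      using \<mu> by (auto simp: field_simps)
    have "\<theta>\<^sup>2 \<le> 1\<^sup>2" using \<theta> by (intro power_mono) auto
    then have \<mu>2: "\<mu> \<in> {0<..<1}" using \<mu> by auto
    \<comment> \<open>This \<open>k\<close> is a fresh variable for the induction; the one chosen
      above is inserted afterwards.\<close>
    have "\<forall>\<omega>\<in>\<Omega>. \<bar>w \<mu> \<omega> - u \<omega>\<bar> \<le> (1 - \<theta> / 2) ^ k + 24 * \<theta>" for k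
    proof (induction k)
      case 0
      have "\<bar>w \<mu> \<omega> - u \<omega>\<bar> \<le> (1 - \<theta> / 2) ^ 0 + 24 * \<theta>" if "\<omega> \<in> \<Omega>" for \<omega>
        using w_bounds[OF \<mu>2 that] u[OF that] \<theta> by (simp add: abs_le_iff)
      then show ?case by blast
    next
      case (Suc k)
      have "\<bar>w \<mu> \<omega> - u \<omega>\<bar> \<le> (1 - \<theta> / 2) * ((1 - \<theta> / 2) ^ k + 24 * \<theta>) + 12 * \<theta>\<^sup>2"
        if "\<omega> \<in> \<Omega>" for \<omega>
        using Suc.IH \<theta> that
        by (intro w_contraction[OF u \<theta>(1,2) \<mu>(1) \<mu>1 N]) auto
      then show ?case by (simp add: algebra_simps power2_eq_square)
    qed
    then have "\<bar>w \<mu> \<omega> - u \<omega>\<bar> \<le> (1 - \<theta> / 2) ^ k + 24 * \<theta>" using \<omega> by blast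
    with k \<theta>(3) show ?thesis by (simp add: dist_real_def)
  qed
  then show "\<forall>\<^sub>F \<mu> in at_right 0. \<forall>\<omega>\<in>\<Omega>. dist (w \<mu> \<omega>) (u \<omega>) < e"
    using \<theta> unfolding eventually_at_right_field
    by (intro exI[of _ "min (\<theta>\<^sup>2) (1 / (2 * (real N + 1)))"]) auto
qed

text \<open>The fixed point is now \<open>10 * \<theta>\<close>. Each iteration improves the bound
  only on a shorter tail, so the induction on \<open>k\<close> carries an existential
  \<open>N\<close>; since \<open>k\<close> depends on \<open>\<theta>\<close> alone, finitely many
  enlargements of \<open>N\<close> suffice.\<close>

lemma uniform_limit_v:
  assumes lim: "uniform_limit \<Omega> w u (at_right 0)"
  shows "uniform_limit \<Omega> v u sequentially"
proof (rule uniform_limitI)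
  fix e :: real assume "e > 0"
  define \<theta> where "\<theta> = min (1/8) (e / 50)"
  have \<theta>: "0 < \<theta>" "\<theta> \<le> 1/8" "11 * \<theta> < e" unfolding \<theta>_def using \<open>e > 0\<close> by auto
  have u: "u \<omega> \<in> {0..1}" if "\<omega> \<in> \<Omega>" for \<omega>
  proof (rule Lim_in_closed_set[OF _ _ _ tendsto_uniform_limitI[OF lim that]])
    show "\<forall>\<^sub>F \<mu> in at_right 0. w \<mu> \<omega> \<in> {0..1}"
      by (rule eventually_at_rightI[of 0 1]) (use w_bounds[OF _ that] in auto)
  qed auto
  obtain b where b: "b > 0" "\<And>\<mu> \<omega>. 0 < \<mu> \<Longrightarrow> \<mu> < b \<Longrightarrow> \<omega> \<in> \<Omega> \<Longrightarrow> \<bar>w \<mu> \<omega> - u \<omega>\<bar> \<le> \<theta>\<^sup>2"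
    using uniform_limitD[OF lim, of "\<theta>\<^sup>2"] \<theta>
    by (force simp: eventually_at_right_field dist_real_def intro: less_imp_le)
  obtain k where k: "(1 - \<theta>) ^ k < \<theta>"
    using real_arch_pow_inv[of \<theta> "1 - \<theta>"] \<theta> by auto
  have "\<exists>N. \<forall>n\<ge>N. n \<ge> 1 \<longrightarrow> (\<forall>\<omega>\<in>\<Omega>. \<bar>v n \<omega> - u \<omega>\<bar> \<le> (1 - \<theta>) ^ k + 10 * \<theta>)" for k
  proof (induction k)
    case 0
    have "\<bar>v n \<omega> - u \<omega>\<bar> \<le> (1 - \<theta>) ^ 0 + 10 * \<theta>" if "n \<ge> 1" "\<omega> \<in> \<Omega>" for n \<omega>
      using v_bounds[OF that] u[OF that(2)] \<theta> by (simp add: abs_le_iff)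
    then show ?case by blast
  next
    case (Suc k)
    then obtain N where N: "\<And>n \<omega>. n \<ge> N \<Longrightarrow> n \<ge> 1 \<Longrightarrow> \<omega> \<in> \<Omega> \<Longrightarrow>
        \<bar>v n \<omega> - u \<omega>\<bar> \<le> (1 - \<theta>) ^ k + 10 * \<theta>" by blast
    \<comment> \<open>The three bounds make the rounding of the block harmless, keep
      \<open>n\<close> in the previous tail, and put \<open>1 / m\<close> below
      \<open>b\<close>.\<close>
    obtain M :: nat where M: "real M > max (1 / \<theta>) (max (2 * real N) (1 / b))"
      using reals_Archimedean2 by blast
    have "\<bar>v m \<omega> - u \<omega>\<bar> \<le> (1 - \<theta>) ^ Suc k + 10 * \<theta>" if m: "m \<ge> M" and \<omega>: "\<omega> \<in> \<Omega>" for m \<omega>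
    proof -
      have mm: "real m > 1 / \<theta>" "real m > 2 * real N" "real m > 1 / b"
        using M m by linarith+
      have m1: "1 \<le> \<theta> * real m" "2 * real N \<le> real m" "0 < 1 / real m" "1 / real m < b"
        using mm \<theta> b by (auto simp: field_simps)
      have "\<bar>v m \<omega> - u \<omega>\<bar> \<le> (1 - \<theta>) * ((1 - \<theta>) ^ k + 10 * \<theta>) + 10 * \<theta>\<^sup>2"
        using \<theta> \<omega>
        by (intro v_contraction[OF u \<theta>(1,2) m1(1,2) b(2)[OF m1(3,4)] N]) auto
      then show ?thesis by (simp add: algebra_simps power2_eq_square)
    qed
    then show ?case by blast
  qed
  then obtain N where N: "\<And>n \<omega>. n \<ge> N \<Longrightarrow> n \<ge> 1 \<Longrightarrow> \<omega> \<in> \<Omega> \<Longrightarrow>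
      \<bar>v n \<omega> - u \<omega>\<bar> \<le> (1 - \<theta>) ^ k + 10 * \<theta>" by blast
  show "\<forall>\<^sub>F n in sequentially. \<forall>\<omega>\<in>\<Omega>. dist (v n \<omega>) (u \<omega>) < e"
  proof (intro eventually_sequentiallyI[of "max N 1"] ballI)
    fix n \<omega> assume "max N 1 \<le> n" "\<omega> \<in> \<Omega>"
    then have "\<bar>v n \<omega> - u \<omega>\<bar> \<le> (1 - \<theta>) ^ k + 10 * \<theta>" using N by simp
    with k \<theta>(3) show "dist (v n \<omega>) (u \<omega>) < e" by (simp add: dist_real_def)
  qed
qed

end

section \<open>Order properties of game value maps and ranges of the payoffs\<close>

text \<open>The affine axiom extends monotonicity to payoffs of different scale, as needed for total
  costs with factors \<open>n + h\<close> and \<open>1 / \<mu>\<close>.\<close>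

lemma game_value_map_affine_le:
  assumes V: "game_value_map \<Omega> K C V" and C: "payoff_class K C"
    and c: "c1 \<in> C" "c2 \<in> C" and A: "0 \<le> A1" "0 \<le> A2"
    and le: "\<And>z. z \<in> K \<Longrightarrow> A1 * c1 z \<le> A2 * c2 z + B" and \<omega>: "\<omega> \<in> \<Omega>"
  shows "A1 * V c1 \<omega> \<le> A2 * V c2 \<omega> + B"
proof -
  \<comment> \<open>The summand 0 keeps \<open>?d1\<close> in the shape \<open>A * c z + B\<close>
    of the axioms.\<close>
  let ?d1 = "\<lambda>z\<in>K. A1 * c1 z + 0" and ?d2 = "\<lambda>z\<in>K. A2 * c2 z + B"
  have "?d1 \<in> C" "?d2 \<in> C" using C c A unfolding payoff_class_def by blast+
  moreover have "\<forall>z\<in>K. ?d1 z \<le> ?d2 z" using le by simp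
  ultimately have "V ?d1 \<omega> \<le> V ?d2 \<omega>" using V \<omega> unfolding game_value_map_def by blast
  moreover have "V ?d1 \<omega> = A1 * V c1 \<omega> + 0" "V ?d2 \<omega> = A2 * V c2 \<omega> + B"
    using V c A \<omega> unfolding game_value_map_def by blast+
  ultimately show ?thesis by simp
qed

text \<open>The constants 0 and 1 enter as \<open>c\<close> with coefficient 0, so they lie in
  \<open>C\<close> automatically.\<close>

lemma game_value_map_unit_interval:
  assumes "game_value_map \<Omega> K C V" "payoff_class K C" "c \<in> C"
    and "\<And>z. z \<in> K \<Longrightarrow> c z \<in> {0..1}" and "\<omega> \<in> \<Omega>"
  shows "V c \<omega> \<in> {0..1}"
  using game_value_map_affine_le[OF assms(1-3,3), of 0 1 0 \<omega>]
    game_value_map_affine_le[OF assms(1-3,3), of 1 0 1 \<omega>] assms(4,5) by simp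

lemma v_bar_unit_interval:
  assumes "n \<ge> 1" "z \<in> K" "\<And>t. g (z (real t)) \<in> {0..1}"
  shows "v_bar g K n z \<in> {0..1}"
proof -
  have "(\<Sum>t<n. g (z (real t))) \<le> (\<Sum>t<n. 1)" using assms(3) by (intro sum_mono) auto
  moreover have "0 \<le> (\<Sum>t<n. g (z (real t)))" using assms(3) by (intro sum_nonneg) auto
  ultimately show ?thesis using assms(1,2) by (simp add: v_bar_def field_simps)
qed

text \<open>Domination by the geometric series with sum \<open>1 / \<mu>\<close> gives both the
  bound and the summability of the series.\<close>

lemma w_bar_unit_interval:
  assumes "\<mu> \<in> {0<..<1}" "z \<in> K" "\<And>t. g (z (real t)) \<in> {0..1}"
  shows "w_bar g K \<mu> z \<in> {0..1}"
proof -
  let ?f = "\<lambda>t. (1 - \<mu>) ^ t * g (z (real t))"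
  have f: "0 \<le> ?f t" "?f t \<le> (1 - \<mu>) ^ t" for t
    using assms(1) assms(3)[of t] by (auto intro: mult_left_le)
  have geo: "(\<lambda>t. (1 - \<mu>) ^ t) sums (1 / \<mu>)"
    using geometric_sums[of "1 - \<mu>"] assms(1) by simp
  have sf: "summable ?f"
  proof (rule summable_comparison_test'[OF sums_summable[OF geo]])
    show "norm (?f t) \<le> (1 - \<mu>) ^ t" if "t \<ge> 0" for t
      using f[of t] by (simp only: real_norm_def abs_of_nonneg)
  qed
  have "suminf ?f \<le> 1 / \<mu>"
    using suminf_le[OF f(2) sf sums_summable[OF geo]] sums_unique[OF geo] by simp
  moreover have "0 \<le> suminf ?f" using f(1) sf by (intro suminf_nonneg)
  ultimately show ?thesis using assms(1,2) by (simp add: w_bar_def field_simps)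
qed

section \<open>From dynamic programming to coupled values and the equivalence\<close>

text \<open>The dynamic programming principles replace both payoffs by ones that run a single block
  and then pay the value of the state reached. Their total costs are compared along each process,
  and affine monotonicity passes the comparison on to the values.\<close>

lemma DPP_coupled_values:
  assumes K: "K \<subseteq> {0..} \<rightarrow>\<^sub>E \<Omega>" and g: "g \<in> \<Omega> \<rightarrow> {0..1}"
    and C: "payoff_class K C" and V: "game_value_map \<Omega> K C V"
    and vC: "\<And>n. n \<ge> 1 \<Longrightarrow> v_bar g K n \<in> C"
    and wC: "\<And>\<mu>. \<mu> \<in> {0<..<1} \<Longrightarrow> w_bar g K \<mu> \<in> C"
    and DPP: "DPP_v g K C V" "DPP_w g K C V"
  shows "coupled_values \<Omega> (\<lambda>n. V (v_bar g K n)) (\<lambda>\<mu>. V (w_bar g K \<mu>))"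
proof
  have z\<Omega>: "z (real t) \<in> \<Omega>" if "z \<in> K" for z t using K that by (auto simp: PiE_iff)
  then have gz: "g (z (real t)) \<in> {0..1}" if "z \<in> K" for z t using g that by blast
  show "V (v_bar g K n) \<omega> \<in> {0..1}" if "n \<ge> 1" "\<omega> \<in> \<Omega>" for n \<omega>
    using game_value_map_unit_interval[OF V C vC] v_bar_unit_interval gz that by metis
  show "V (w_bar g K \<mu>) \<omega> \<in> {0..1}" if "\<mu> \<in> {0<..<1}" "\<omega> \<in> \<Omega>" for \<mu> \<omega>
    using game_value_map_unit_interval[OF V C wC] w_bar_unit_interval gz that by metis
  fix n h :: nat and \<mu> E :: real and \<omega>
  assume n: "n \<ge> 1" and h: "h \<ge> 1" and \<mu>: "\<mu> \<in> {0<..<1}" and \<omega>: "\<omega> \<in> \<Omega>"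
    and E: "\<And>\<omega>. \<omega> \<in> \<Omega> \<Longrightarrow>
      \<bar>real n * V (v_bar g K n) \<omega> - (1 - \<mu>) ^ h * (V (w_bar g K \<mu>) \<omega> / \<mu>)\<bar> \<le> E"
  define c1 where "c1 = (\<lambda>z\<in>K. 1 / real (n + h) * (\<Sum>t<h. g (z (real t)))
                       + real n / real (n + h) * V (v_bar g K n) (z (real h)))"
  define c2 where "c2 = (\<lambda>z\<in>K. \<mu> * (\<Sum>t<h. (1 - \<mu>) ^ t * g (z (real t)))
                       + (1 - \<mu>) ^ h * V (w_bar g K \<mu>) (z (real h)))"
  have c1: "c1 \<in> C" "V c1 = V (v_bar g K (n + h))"
    using DPP(1) n h unfolding DPP_v_def Let_def c1_def by blast+
  have c2: "c2 \<in> C" "V c2 = V (w_bar g K \<mu>)"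
    using DPP(2) \<mu> h unfolding DPP_w_def Let_def c2_def by blast+
  \<comment> \<open>The interval is asymmetric because the stage weights 1 dominate
    \<open>(1 - \<mu>) ^ t\<close>; \<open>E\<close> covers the continuation from
    \<open>z h\<close>.\<close>
  have diff: "real (n + h) * c1 z - 1 / \<mu> * c2 z \<in> {- E..E + \<mu> * (real h)\<^sup>2}" if z: "z \<in> K" for z
  proof -
    have "real (n + h) * c1 z
        = (\<Sum>t<h. g (z (real t))) + real n * V (v_bar g K n) (z (real h))"
      using n z by (simp add: c1_def distrib_left)
    moreover have "1 / \<mu> * c2 z = (\<Sum>t<h. (1 - \<mu>) ^ t * g (z (real t)))
        + (1 - \<mu>) ^ h * (V (w_bar g K \<mu>) (z (real h)) / \<mu>)"
      using \<mu> z by (simp add: c2_def add_divide_distrib)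
    moreover have "(\<Sum>t<h. g (z (real t))) - (\<Sum>t<h. (1 - \<mu>) ^ t * g (z (real t)))
        = (\<Sum>t<h. (1 - (1 - \<mu>) ^ t) * g (z (real t)))"
      by (simp add: sum_subtractf left_diff_distrib)
    moreover have "0 \<le> (\<Sum>t<h. (1 - (1 - \<mu>) ^ t) * g (z (real t)))"
      using \<mu> gz[OF z] by (intro sum_nonneg mult_nonneg_nonneg) (auto simp: power_le_one)
    \<comment> \<open>By Bernoulli the weight gap at stage \<open>t\<close> is at most
      \<open>t * \<mu>\<close>, hence at most \<open>h * \<mu>\<close>.\<close>
    moreover have "(\<Sum>t<h. (1 - (1 - \<mu>) ^ t) * g (z (real t))) \<le> (\<Sum>t<h. (real h * \<mu>) * 1)"
    proof (intro sum_mono mult_mono)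
      fix t assume "t \<in> {..<h}"
      then have "real t * \<mu> \<le> real h * \<mu>" using \<mu> by (intro mult_right_mono) auto
      moreover have "1 - real t * \<mu> \<le> (1 - \<mu>) ^ t"
        using Bernoulli_inequality[of "- \<mu>" t] \<mu> by simp
      ultimately show "1 - (1 - \<mu>) ^ t \<le> real h * \<mu>" by linarith
    qed (use \<mu> gz[OF z] in auto)
    moreover have "(\<Sum>t<h. (real h * \<mu>) * 1) = \<mu> * (real h)\<^sup>2"
      by (simp add: power2_eq_square)
    moreover note E[OF z\<Omega>[OF z, of h]]
    ultimately show ?thesis unfolding atLeastAtMost_iff abs_le_iff by linarith
  qed
  have "real (n + h) * V c1 \<omega> \<le> 1 / \<mu> * V c2 \<omega> + (E + \<mu> * (real h)\<^sup>2)"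
    using \<mu> diff \<omega> by (intro game_value_map_affine_le[OF V C c1(1) c2(1)]) (auto simp: algebra_simps)
  moreover have "1 / \<mu> * V c2 \<omega> \<le> real (n + h) * V c1 \<omega> + E"
    using \<mu> diff \<omega> by (intro game_value_map_affine_le[OF V C c2(1) c1(1)]) (auto simp: algebra_simps)
  moreover have "0 \<le> \<mu> * (real h)\<^sup>2" using \<mu> by simp
  ultimately show "\<bar>real (n + h) * V (v_bar g K (n + h)) \<omega> - V (w_bar g K \<mu>) \<omega> / \<mu>\<bar>
      \<le> E + \<mu> * (real h)\<^sup>2"
    unfolding c1(2) c2(2) by (simp add: abs_le_iff)
qed

theorem theorem3:
  fixes \<Omega> :: "'w set" and K :: "(real \<Rightarrow> 'w) set" and g :: "'w \<Rightarrow> real"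
    and C :: "((real \<Rightarrow> 'w) \<Rightarrow> real) set"
    and V :: "((real \<Rightarrow> 'w) \<Rightarrow> real) \<Rightarrow> 'w \<Rightarrow> real"
  assumes "\<Omega> \<noteq> {}"
    and "K \<noteq> {}" and "K \<subseteq> {0..} \<rightarrow>\<^sub>E \<Omega>"
    and "g \<in> \<Omega> \<rightarrow> {0..1}"
    and "\<And>z. z \<in> K \<Longrightarrow> (\<lambda>t. g (z t)) \<in> borel_measurable (restrict_space borel {0..})"
    and "\<And>z (k::nat) t. z \<in> K \<Longrightarrow> t \<in> {0<..<1} \<Longrightarrow> z (real k + t) = z (real k)"
    and "payoff_class K C"
    and "game_value_map \<Omega> K C V"
    and "\<And>n. n \<ge> 1 \<Longrightarrow> v_bar g K n \<in> C"
    and "\<And>\<mu>. \<mu> \<in> {0<..<1} \<Longrightarrow> w_bar g K \<mu> \<in> C"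
    and "DPP_v g K C V"
    and "DPP_w g K C V"
  shows "((\<exists>u. uniform_limit \<Omega> (\<lambda>n. V (v_bar g K n)) u sequentially) \<longleftrightarrow>
          (\<exists>u. uniform_limit \<Omega> (\<lambda>\<mu>. V (w_bar g K \<mu>)) u (at_right 0))) \<and>
         ((\<exists>u. uniform_limit \<Omega> (\<lambda>n. V (v_bar g K n)) u sequentially) \<or>
          (\<exists>u. uniform_limit \<Omega> (\<lambda>\<mu>. V (w_bar g K \<mu>)) u (at_right 0)) \<longrightarrow>
          (\<forall>\<omega>\<in>\<Omega>. \<exists>l. (\<lambda>n. V (v_bar g K n) \<omega>) \<longlonglongrightarrow> l \<and>
                      ((\<lambda>\<mu>. V (w_bar g K \<mu>) \<omega>) \<longlongrightarrow> l) (at_right 0)))"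
proof -
  interpret coupled_values \<Omega> "\<lambda>n. V (v_bar g K n)" "\<lambda>\<mu>. V (w_bar g K \<mu>)"
    by (rule DPP_coupled_values[OF assms(3,4,7-12)])
  let ?v = "\<lambda>n. V (v_bar g K n)" and ?w = "\<lambda>\<mu>. V (w_bar g K \<mu>)"
  \<comment> \<open>Both transfers preserve \<open>u\<close>, so this yields the equivalence and the
    equality of the limits at once.\<close>
  have iff: "uniform_limit \<Omega> ?v u sequentially \<longleftrightarrow> uniform_limit \<Omega> ?w u (at_right 0)" for u
    using uniform_limit_w uniform_limit_v by (rule iffI)
  have "\<exists>l. (\<lambda>n. ?v n \<omega>) \<longlonglongrightarrow> l \<and> ((\<lambda>\<mu>. ?w \<mu> \<omega>) \<longlongrightarrow> l) (at_right 0)"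
    if u: "uniform_limit \<Omega> ?w u (at_right 0)" and \<omega>: "\<omega> \<in> \<Omega>" for u \<omega>
    using tendsto_uniform_limitI[OF u \<omega>] tendsto_uniform_limitI[OF u[folded iff] \<omega>] by blast
  then show ?thesis unfolding iff by blast
qed

end
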